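(* Let $\alpha>-1$, $t\ge 0$ and let $n\ge 1$ be an integer. Then the monic orthogonal polynomial $P_n(x)=P_n(x;t,\alpha)$ satisfies, for $x\in(0,\infty)$, the second-order differential equation $$P_n''(x)-\left(\mathrm v'(x)+\frac{A_n'(x)}{A_n(x)}\right)P_n'(x)+\left(B_n'(x)-B_n^2(x)-\mathrm v'(x)B_n(x)+\beta_nA_n(x)A_{n-1}(x)-\frac{A_n'(x)B_n(x)}{A_n(x)}\right)P_n(x)=0,$$ where $'$ denotes $\frac{d}{dx}$, $\mathrm v'(x)=1-\frac{\alpha}{x}-\frac{t}{x^2}$, $$A_n(x)=\frac1x+\frac{\alpha_n(t)-2n-1-\alpha}{x^2},$$ $$B_n(x)=-\frac nx+\frac{nt-\beta_n(t)\left(\alpha_n(t)+\alpha_{n-1}(t)-4n-2\alpha\right)}{(2n+\alpha)x^2},$$ and $A_{n-1}(x)$ is given by the formula for $A_n(x)$ with $n$ replaced by $n-1$.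
   Context: For $\alpha>-1$, $t\ge0$, the singularly perturbed Laguerre weight is $w(x;t,\alpha)=x^\alpha e^{-x-t/x}$ on $(0,\infty)$. $P_n(x;t,\alpha)$, $n=0,1,2,\dots$, are the monic orthogonal polynomials of degree $n$ with respect to $w$: $\int_0^\infty P_jP_kw\,dx=h_j\delta_{jk}$, $h_j>0$. The recurrence coefficients $\alpha_n=\alpha_n(t)$, $\beta_n=\beta_n(t)$ (depending also on $\alpha$; $\alpha_n$ is not to be confused with the parameter $\alpha$) are defined by $xP_n=P_{n+1}+\alpha_nP_n+\beta_nP_{n-1}$ with $P_0=1$, $\beta_0P_{-1}=0$. *)

theory Defs
  imports "HOL-Analysis.Analysis" "HOL-Computational_Algebra.Polynomial"
begin

definition laguerre_weight :: "real \<Rightarrow> real \<Rightarrow> real \<Rightarrow> real" where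
  "laguerre_weight t \<alpha> x = x powr \<alpha> * exp (- x - t / x)"

text \<open>The integrals are Lebesgue integrals over the half-line. Integrability is not part of the
  definition: it always holds for the weight above when \<open>\<alpha> > -1\<close> and \<open>t \<ge> 0\<close>.\<close>

definition monic_orthogonal_polys :: "(real \<Rightarrow> real) \<Rightarrow> (nat \<Rightarrow> real poly) \<Rightarrow> bool" where
  "monic_orthogonal_polys w P \<longleftrightarrow>
     (\<forall>n. degree (P n) = n \<and> lead_coeff (P n) = 1) \<and>
     (\<exists>h :: nat \<Rightarrow> real. (\<forall>j. h j > 0) \<and>
        (\<forall>j k. (LBINT x:{0<..}. poly (P j) x * poly (P k) x * w x) = (if j = k then h j else 0)))"

text \<open>Here \<open>a n\<close> and \<open>b n\<close> stand for the recurrence coefficients \<open>\<alpha>\<^sub>n\<close> and \<open>\<beta>\<^sub>n\<close>. The convention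
  \<open>\<beta>\<^sub>0 P\<^sub>-\<^sub>1 = 0\<close> drops the last term for \<open>n = 0\<close>, so \<open>b 0\<close> is unconstrained.\<close>

definition recurrence_coeffs :: "(nat \<Rightarrow> real poly) \<Rightarrow> (nat \<Rightarrow> real) \<Rightarrow> (nat \<Rightarrow> real) \<Rightarrow> bool" where
  "recurrence_coeffs P a b \<longleftrightarrow>
     (\<forall>n. [:0, 1:] * P n =
        P (Suc n) + smult (a n) (P n) + (if n = 0 then 0 else smult (b n) (P (n - 1))))"

text \<open>The derivative \<open>v'\<close> of the potential \<open>v = - ln w\<close>.\<close>

definition v_deriv :: "real \<Rightarrow> real \<Rightarrow> real \<Rightarrow> real" where
  "v_deriv t \<alpha> x = 1 - \<alpha> / x - t / x\<^sup>2"

definition ladder_A :: "real \<Rightarrow> (nat \<Rightarrow> real) \<Rightarrow> nat \<Rightarrow> real \<Rightarrow> real" where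
  "ladder_A \<alpha> a n x = 1 / x + (a n - 2 * real n - 1 - \<alpha>) / x\<^sup>2"

text \<open>Only meaningful for \<open>n \<ge> 1\<close>, since it refers to \<open>a (n - 1)\<close>.\<close>

definition ladder_B ::
  "real \<Rightarrow> real \<Rightarrow> (nat \<Rightarrow> real) \<Rightarrow> (nat \<Rightarrow> real) \<Rightarrow> nat \<Rightarrow> real \<Rightarrow> real" where
  "ladder_B t \<alpha> a b n x =
     - real n / x +
     (real n * t - b n * (a n + a (n - 1) - 4 * real n - 2 * \<alpha>)) / ((2 * real n + \<alpha>) * x\<^sup>2)"

end

theory Submission
  imports Defs "HOL-Real_Asymp.Real_Asymp"
begin

text \<open>Integrating the derivative of \<open>x q(x) w(x)\<close> over the half-line gives, with
  \<open>q = x p\<close>, the relation \<open>L (x\<^sup>2 p' + ((2 + \<alpha>) x + t - x\<^sup>2) p) = 0\<close> for the moment functional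
  \<open>L\<close>. It makes \<open>x\<^sup>2 P\<^sub>n'\<close> orthogonal to \<open>P\<^sub>k\<close> for \<open>k < n - 2\<close>, so that \<open>x\<^sup>2 P\<^sub>n'\<close> is a combination
  of \<open>P\<^sub>n\<^sub>+\<^sub>1, \<dots>, P\<^sub>n\<^sub>-\<^sub>2\<close>; the three-term recurrence folds this into the lowering relation
  \<open>P\<^sub>n' = \<beta>\<^sub>n A\<^sub>n P\<^sub>n\<^sub>-\<^sub>1 - B\<^sub>n P\<^sub>n\<close> and the raising relation
  \<open>P\<^sub>n\<^sub>-\<^sub>1' = (B\<^sub>n + v') P\<^sub>n\<^sub>-\<^sub>1 - A\<^sub>n\<^sub>-\<^sub>1 P\<^sub>n\<close>. Eliminating \<open>P\<^sub>n\<^sub>-\<^sub>1\<close> yields the equation.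
  The choice \<open>q = P\<^sub>n\<^sup>2\<close> gives \<open>(\<alpha>\<^sub>n - 2 n - 1 - \<alpha>) h\<^sub>n = \<integral> (t / x) P\<^sub>n\<^sup>2 w \<ge> 0\<close>, hence
  \<open>A\<^sub>n > 0\<close>, which justifies the division.\<close>

section \<open>Orthogonal polynomials of an abstract moment functional\<close>

locale orthogonal_sequence =
  fixes L :: "real poly \<Rightarrow> real" and P :: "nat \<Rightarrow> real poly" and h a b :: "nat \<Rightarrow> real"
  assumes L_add: "L (p + q) = L p + L q"
    and L_smult: "L (smult c p) = c * L p"
    and degree_P: "degree (P n) = n"
    and lead_P: "lead_coeff (P n) = 1"
    and h_pos: "h n > 0"
    and orth: "L (P j * P k) = (if j = k then h j else 0)"
    and recurrence: "pCons 0 (P n) = P (Suc n) + smult (a n) (P n) + smult (b n) (P (n - 1))"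
    and b_0: "b 0 = 0" \<comment> \<open>cancels the junk value \<open>P (0 - 1) = P 0\<close> in the recurrence\<close>
begin

lemma L_zero: "L 0 = 0"
  using L_smult[of 0 0] by simp

lemma L_minus: "L (- p) = - L p"
  using L_smult[of "-1" p] by simp

lemma L_diff: "L (p - q) = L p - L q"
  using L_add[of p "- q"] by (simp add: L_minus)

definition ip :: "real poly \<Rightarrow> real poly \<Rightarrow> real" where
  "ip p q = L (p * q)"

lemma ip_linear:
  "ip 0 q = 0" "ip p 0 = 0"
  "ip (p + p') q = ip p q + ip p' q" "ip p (q + q') = ip p q + ip p q'"
  "ip (p - p') q = ip p q - ip p' q" "ip p (q - q') = ip p q - ip p q'"
  "ip (smult c p) q = c * ip p q" "ip p (smult c q) = c * ip p q"
  by (simp_all add: ip_def L_zero L_add L_diff L_smult ring_distribs)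

lemma ip_X: "ip (pCons 0 p) q = ip p (pCons 0 q)"
  by (simp add: ip_def)

lemma ip_X2_commute: "ip (pCons 0 (pCons 0 p)) q = ip (pCons 0 (pCons 0 q)) p"
  by (simp add: ip_def mult.commute)

lemma ip_P_P: "ip (P j) (P k) = (if j = k then h j else 0)"
  by (simp add: ip_def orth)

text \<open>Subtracting \<open>lead_coeff q\<close> times the \<open>P k\<close> of the same degree
  lowers the degree, so by induction only the component of \<open>q\<close> along \<open>P m\<close>
  survives.\<close>

lemma ip_P_right:
  assumes "degree q \<le> m"
  shows "ip q (P m) = coeff q m * h m"
  using assms
proof (induction "degree q" arbitrary: q rule: less_induct)
  case less
  define k where "k = degree q"
  define r where "r = q - smult (lead_coeff q) (P k)"
  have q: "q = r + smult (lead_coeff q) (P k)"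
    by (simp add: r_def)
  have deg: "degree r \<le> k"
    unfolding r_def using degree_P[of k] k_def
    by (intro degree_diff_le order.trans[OF degree_smult_le]) auto
  have ck: "coeff r k = 0"
    using lead_P[of k] by (simp add: r_def k_def degree_P)
  have Lr: "ip r (P m) = coeff r m * h m"
  proof (cases "degree r < k")
    case True
    then show ?thesis using less unfolding k_def by simp
  next
    case False
    then have "r = 0" using deg ck
      by (metis le_neq_implies_less leading_coeff_0_iff)
    then show ?thesis by (simp add: ip_linear)
  qed
  have cP: "coeff (P k) m = (if k = m then 1 else 0)"
    using less.prems lead_P[of k] degree_P[of k] by (auto simp: k_def coeff_eq_0)
  have "ip q (P m) = ip r (P m) + lead_coeff q * ip (P k) (P m)"
    by (subst q) (simp add: ip_linear)
  moreover have "coeff q m = coeff r m + lead_coeff q * coeff (P k) m"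
    by (subst q) simp
  ultimately show ?case
    by (simp add: Lr ip_P_P cP algebra_simps)
qed

lemma eq_0_if_orthogonal:
  assumes "\<And>m. ip q (P m) = 0"
  shows "q = 0"
  using assms[of "degree q"] ip_P_right[of q "degree q"] h_pos[of "degree q"] by simp

lemma P_0: "P 0 = 1"
  using degree_P[of 0] lead_P[of 0] by (auto elim!: degree_eq_zeroE simp: one_pCons)

text \<open>Multiplication by x is symmetric for \<open>ip\<close>; its entry between
  \<open>P (Suc n)\<close> and \<open>P n\<close> is read off from either side.\<close>

lemma h_Suc: "h (Suc n) = b (Suc n) * h n"
  using ip_X[of "P (Suc n)" "P n"] unfolding recurrence
  by (simp add: ip_linear ip_P_P b_0 split: if_splits)

text \<open>These are the entries of the Jacobi matrix; \<open>h_Suc\<close> removes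
  \<open>b\<close> from the off-diagonal ones. Entries of its square follow by moving one factor x
  to the right.\<close>

lemma ip_X_P_P:
  "ip (pCons 0 (P n)) (P m) =
    (if m = n then a n * h n else if m = Suc n then h m else if Suc m = n then h n else 0)"
proof (cases n)
  case 0
  then show ?thesis
    by (simp add: recurrence ip_linear ip_P_P b_0)
next
  case (Suc k)
  have "ip (pCons 0 (P n)) (P m) = (if Suc n = m then h m else 0)
      + a n * (if n = m then h m else 0) + b n * (if k = m then h k else 0)"
    unfolding recurrence ip_linear ip_P_P using Suc by simp
  also have "b n * (if k = m then h k else 0) = (if k = m then h n else 0)"
    using h_Suc[of k] Suc by auto
  finally show ?thesis
    using Suc by simp
qed

lemma ip_X2_P_P: "ip (pCons 0 (pCons 0 (P n))) (P n) = (b (Suc n) + (a n)\<^sup>2 + b n) * h n"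
proof -
  have "ip (pCons 0 (pCons 0 (P n))) (P n)
     = ip (pCons 0 (P n)) (P (Suc n) + smult (a n) (P n) + smult (b n) (P (n - 1)))"
    by (simp only: ip_X[of "pCons 0 (P n)"] flip: recurrence)
  also have "\<dots> = h (Suc n) + a n * (a n * h n) + b n * h n"
    unfolding ip_linear ip_X_P_P by (cases n) (simp_all add: b_0)
  finally show ?thesis
    by (simp add: h_Suc algebra_simps power2_eq_square)
qed

lemma ip_X2_P_P_Suc:
  "ip (pCons 0 (pCons 0 (P n))) (P (Suc n)) = (a n + a (Suc n)) * h (Suc n)"
proof -
  have "ip (pCons 0 (pCons 0 (P n))) (P (Suc n))
     = ip (pCons 0 (P n)) (P (Suc (Suc n)) + smult (a (Suc n)) (P (Suc n)) + smult (b (Suc n)) (P n))"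
    using recurrence[of "Suc n"] by (simp only: ip_X[of "pCons 0 (P n)"] diff_Suc_1)
  also have "\<dots> = a (Suc n) * h (Suc n) + b (Suc n) * (a n * h n)"
    unfolding ip_linear ip_X_P_P by simp
  finally show ?thesis
    by (simp add: h_Suc algebra_simps)
qed

end

section \<open>Matrix entries of x^2 d/dx in the basis \<open>P\<close>, and the identities they
  force\<close>

text \<open>The operator \<open>x\<^sup>2 d/dx\<close>: multiplying by \<open>x\<^sup>2\<close> clears the denominators of \<open>v'\<close>, \<open>A\<^sub>n\<close> and \<open>B\<^sub>n\<close>.\<close>

definition x2_pderiv :: "real poly \<Rightarrow> real poly" where
  "x2_pderiv p = pCons 0 (pCons 0 (pderiv p))"

lemma x2_pderiv_pCons: "x2_pderiv (pCons 0 p) = pCons 0 (pCons 0 p) + pCons 0 (x2_pderiv p)"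
  by (simp add: x2_pderiv_def pderiv_pCons)

lemma x2_pderiv_linear:
  "x2_pderiv (p + q) = x2_pderiv p + x2_pderiv q"
  "x2_pderiv (p - q) = x2_pderiv p - x2_pderiv q"
  "x2_pderiv (smult c p) = smult c (x2_pderiv p)"
  by (simp_all add: x2_pderiv_def pderiv_add pderiv_diff pderiv_smult)

text \<open>The only trace of the weight is \<open>pearson\<close>, the moment form of (x^2 w)' =
  ((2 + \<alpha>) x + t - x^2) w. The factor x^2 keeps every argument of \<open>L\<close> a
  polynomial.\<close>

locale laguerre_sequence = orthogonal_sequence +
  fixes \<alpha> t :: real
  assumes pearson:
    "L (x2_pderiv p) + (2 + \<alpha>) * L (pCons 0 p) + t * L p - L (pCons 0 (pCons 0 p)) = 0"
begin

lemma parts: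
  "ip (x2_pderiv p) q = - ip (x2_pderiv q) p - (2 + \<alpha>) * ip (pCons 0 p) q - t * ip p q
     + ip (pCons 0 (pCons 0 p)) q"
proof -
  have "x2_pderiv (p * q) = x2_pderiv p * q + x2_pderiv q * p"
    by (simp add: x2_pderiv_def pderiv_mult algebra_simps)
  then show ?thesis
    using pearson[of "p * q"] by (simp add: ip_def L_add)
qed

lemma degree_x2_pderiv_P: "degree (x2_pderiv (P n)) \<le> Suc n"
  by (cases n) (simp_all add: x2_pderiv_def degree_P degree_pderiv P_0)

lemma ip_x2_pderiv_above: "Suc n < m \<Longrightarrow> ip (x2_pderiv (P n)) (P m) = 0"
  using degree_x2_pderiv_P[of n] by (simp add: ip_P_right coeff_eq_0)

lemma ip_x2_pderiv_Suc: "ip (x2_pderiv (P n)) (P (Suc n)) = n * h (Suc n)"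
proof -
  have "coeff (x2_pderiv (P n)) (Suc n) = n"
    using lead_P[of n] by (cases n) (simp_all add: x2_pderiv_def degree_P coeff_pderiv P_0)
  then show ?thesis
    using degree_x2_pderiv_P[of n] by (simp add: ip_P_right)
qed

text \<open>With equal arguments, \<open>parts\<close> has the same unknown on both sides, whence
  the factor 2.\<close>

lemma ip_x2_pderiv_diag:
  "2 * ip (x2_pderiv (P n)) (P n) = (b (Suc n) + (a n)\<^sup>2 + b n - (2 + \<alpha>) * a n - t) * h n"
  using parts[of "P n" "P n"] by (simp add: ip_X_P_P ip_X2_P_P ip_P_P algebra_simps)

text \<open>Transposing with \<open>parts\<close> turns the unknown into the superdiagonal entry,
  which leading coefficients determine.\<close>

lemma ip_x2_pderiv_pred:
  "ip (x2_pderiv (P (Suc n))) (P n) = (a (Suc n) + a n - n - 2 - \<alpha>) * h (Suc n)"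
proof -
  have "ip (pCons 0 (pCons 0 (P (Suc n)))) (P n) = ip (pCons 0 (pCons 0 (P n))) (P (Suc n))"
    by (rule ip_X2_commute)
  then show ?thesis
    using parts[of "P (Suc n)" "P n"]
    by (simp add: ip_x2_pderiv_Suc ip_X_P_P ip_X2_P_P_Suc ip_P_P algebra_simps)
qed

text \<open>After \<open>parts\<close> the derivative falls on \<open>P m\<close>, whose image has
  degree below n, so only the x^2 term can contribute.\<close>

lemma ip_x2_pderiv_below:
  assumes "m + 2 \<le> n"
  shows "ip (x2_pderiv (P n)) (P m) = (if m + 2 = n then h n else 0)"
proof -
  have "ip (x2_pderiv (P n)) (P m) = ip (pCons 0 (pCons 0 (P n))) (P m)"
    using assms parts[of "P n" "P m"] by (simp add: ip_x2_pderiv_above ip_X_P_P ip_P_P)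
  also have "\<dots> = ip (pCons 0 (pCons 0 (P m))) (P n)"
    by (rule ip_X2_commute)
  also have "\<dots> = coeff (pCons 0 (pCons 0 (P m))) n * h n"
    using assms by (intro ip_P_right) (simp add: degree_P degree_pCons_eq_if)
  also have "coeff (pCons 0 (pCons 0 (P m))) n = (if m + 2 = n then 1 else 0)"
    using assms lead_P[of m]
    by (auto simp: degree_P coeff_pCons coeff_eq_0 split: nat.splits)
  finally show ?thesis by simp
qed

text \<open>Differentiating the recurrence gives a second way to compute the matrix entries;
  comparison with the first yields \<open>sum_a\<close> and \<open>subdiagonal_step\<close>.\<close>

lemma x2_pderiv_P_Suc:
  "x2_pderiv (P (Suc n)) = pCons 0 (pCons 0 (P n)) + pCons 0 (x2_pderiv (P n))
     - smult (a n) (x2_pderiv (P n)) - smult (b n) (x2_pderiv (P (n - 1)))"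
proof -
  have "P (Suc n) = pCons 0 (P n) - smult (a n) (P n) - smult (b n) (P (n - 1))"
    by (simp add: recurrence)
  then have "x2_pderiv (P (Suc n))
      = x2_pderiv (pCons 0 (P n) - smult (a n) (P n) - smult (b n) (P (n - 1)))"
    by (rule arg_cong)
  then show ?thesis by (simp only: x2_pderiv_linear x2_pderiv_pCons)
qed

lemma ip_x2_pderiv_diag_sum: "ip (x2_pderiv (P n)) (P n) = (n * a n + (\<Sum>j<n. a j)) * h n"
proof (induction n)
  case 0
  then show ?case by (simp add: P_0 x2_pderiv_def ip_linear)
next
  case (Suc n)
  have XD: "ip (pCons 0 (x2_pderiv (P n))) (P (Suc n)) =
     (a (Suc n) * n + n * a n + (\<Sum>j<n. a j)) * h (Suc n)"
    unfolding ip_X recurrence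
    by (simp add: ip_linear ip_x2_pderiv_Suc ip_x2_pderiv_above Suc.IH h_Suc algebra_simps)
  have Z: "b n * ip (x2_pderiv (P (n - 1))) (P (Suc n)) = 0"
    by (cases n) (simp_all add: b_0 ip_x2_pderiv_above)
  show ?case
    unfolding x2_pderiv_P_Suc ip_linear ip_X2_P_P_Suc XD Z ip_x2_pderiv_Suc by (simp add: algebra_simps)
qed

lemma sum_a:
  "2 * (\<Sum>j<n. a j) = b (Suc n) + (a n)\<^sup>2 + b n - (2 + \<alpha>) * a n - t - 2 * n * a n"
proof -
  have "(2 * (n * a n + (\<Sum>j<n. a j))) * h n
      = (b (Suc n) + (a n)\<^sup>2 + b n - (2 + \<alpha>) * a n - t) * h n"
    using ip_x2_pderiv_diag[of n] ip_x2_pderiv_diag_sum[of n] by simp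
  then have "2 * (n * a n + (\<Sum>j<n. a j)) = b (Suc n) + (a n)\<^sup>2 + b n - (2 + \<alpha>) * a n - t"
    using h_pos[of n] by (metis less_irrefl mult_right_cancel)
  then show ?thesis by (simp add: algebra_simps)
qed

text \<open>The entry of \<open>ip_x2_pderiv_pred\<close> is evaluated again through
  \<open>x2_pderiv_P_Suc\<close>, and the positive factor \<open>h n\<close> is cancelled.\<close>

lemma subdiagonal_step:
  "b (Suc n) * (a (Suc n) + a n - 2 * n - 3 - \<alpha>)
    = b n * (a n + a (n - 1) - 2 * n - 1 - \<alpha>) + (a n)\<^sup>2 + 2 * b n"
proof -
  \<comment> \<open>At n = 0 the truncated index \<open>n - 1\<close> is harmless because
    \<open>b 0 = 0\<close>; the same holds for \<open>sup\<close>.\<close>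
  have sub: "b n * ip (x2_pderiv (P n)) (P (n - 1)) = b n * (a n + a (n - 1) - n - 1 - \<alpha>) * h n"
    by (cases n) (simp_all add: b_0 ip_x2_pderiv_pred)
  have sup: "b n * ip (x2_pderiv (P (n - 1))) (P n) = b n * (real n - 1) * h n"
    using ip_x2_pderiv_Suc[of "n - 1"] by (cases n) (simp_all add: b_0)
  have XD: "ip (pCons 0 (x2_pderiv (P n))) (P n) = n * h (Suc n) + a n * ip (x2_pderiv (P n)) (P n)
      + b n * (a n + a (n - 1) - n - 1 - \<alpha>) * h n"
    unfolding ip_X recurrence ip_linear ip_x2_pderiv_Suc sub by simp
  have "((a (Suc n) + a n - n - 2 - \<alpha>) * b (Suc n)) * h n =
    (b (Suc n) + (a n)\<^sup>2 + b n + n * b (Suc n) + b n * (a n + a (n - 1) - n - 1 - \<alpha>)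
      - b n * (real n - 1)) * h n"
    using ip_x2_pderiv_pred[of n] unfolding x2_pderiv_P_Suc ip_linear XD sup h_Suc ip_X2_P_P
    by (simp add: algebra_simps)
  then have "(a (Suc n) + a n - n - 2 - \<alpha>) * b (Suc n) =
    b (Suc n) + (a n)\<^sup>2 + b n + n * b (Suc n) + b n * (a n + a (n - 1) - n - 1 - \<alpha>)
      - b n * (real n - 1)"
    using h_pos[of n] by (metis less_irrefl mult_right_cancel)
  then show ?thesis by (simp add: algebra_simps)
qed

section \<open>Closed form of the ladder coefficient and the two ladder relations\<close>

text \<open>The constant term of \<open>x\<^sup>2 B\<^sub>n(x)\<close>. It arises as \<open>\<beta>\<^sub>n\<close> plus the subleading coefficient of \<open>P\<^sub>n\<close>.\<close>

definition ladder_r :: "nat \<Rightarrow> real" where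
  "ladder_r n = b n - (\<Sum>j<n. a j)"

text \<open>The factor \<open>2 * n + \<alpha>\<close> is not divided out: \<alpha> is arbitrary
  here, so it may vanish.\<close>

lemma ladder_r_eq: "(2 * n + \<alpha>) * ladder_r n = n * t - b n * (a n + a (n - 1) - 4 * n - 2 * \<alpha>)"
proof (induction n)
  case 0
  then show ?case by (simp add: ladder_r_def b_0)
next
  case (Suc n)
  define S where "S = (\<Sum>j<n. a j)"
  \<comment> \<open>The defect of the claim at \<open>Suc n\<close> is its defect at n plus the
    defect of \<open>subdiagonal_step\<close> minus that of \<open>sum_a\<close>; all three are
    zero.\<close>
  have "(2 * (real n + 1) + \<alpha>) * (b (Suc n) - (S + a n))
      - ((real n + 1) * t - b (Suc n) * (a (Suc n) + a n - 4 * (real n + 1) - 2 * \<alpha>))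
    = ((2 * n + \<alpha>) * (b n - S) - (n * t - b n * (a n + a (n - 1) - 4 * n - 2 * \<alpha>)))
      + (b (Suc n) * (a (Suc n) + a n - 2 * n - 3 - \<alpha>)
          - (b n * (a n + a (n - 1) - 2 * n - 1 - \<alpha>) + (a n)\<^sup>2 + 2 * b n))
      - (2 * S - (b (Suc n) + (a n)\<^sup>2 + b n - (2 + \<alpha>) * a n - t - 2 * n * a n))"
    by (simp add: algebra_simps)
  also have "\<dots> = 0"
    using Suc.IH subdiagonal_step[of n] sum_a[of n] unfolding S_def ladder_r_def
    by (simp only: diff_self) simp
  finally show ?case
    by (simp add: ladder_r_def S_def add.commute)
qed

lemma lowering:
  "x2_pderiv (P n) = smult (b n) (pCons 0 (P (n - 1)) + smult (a n - 2 * n - 1 - \<alpha>) (P (n - 1)))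
     + smult n (pCons 0 (P n)) - smult (ladder_r n) (P n)" (is "_ = ?R")
proof -
  have "ip (x2_pderiv (P n) - ?R) (P m) = 0" for m
  proof -
    have *: "ip (x2_pderiv (P n) - ?R) (P m) = ip (x2_pderiv (P n)) (P m)
      - (b n * (ip (pCons 0 (P (n - 1))) (P m) + (a n - 2 * n - 1 - \<alpha>) * ip (P (n - 1)) (P m))
        + n * ip (pCons 0 (P n)) (P m) - ladder_r n * ip (P n) (P m))"
      unfolding ip_linear by simp
    \<comment> \<open>The cases are the bands of the matrix; the last contains the outermost nonzero
      band m + 2 = n and the zeros beyond it.\<close>
    consider "m > Suc n" | "m = Suc n" | "m = n" | "Suc m = n" | "m + 2 \<le> n"
      by linarith
    then show ?thesis
    proof cases
      case 1
      then show ?thesis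
        unfolding * by (cases n) (simp_all add: ip_X_P_P ip_P_P ip_x2_pderiv_above b_0)
    next
      case 2
      then show ?thesis
        unfolding * by (cases n) (simp_all add: ip_X_P_P ip_P_P ip_x2_pderiv_Suc b_0)
    next
      case 3
      then show ?thesis
        unfolding * ip_X_P_P ip_P_P
        by (cases n) (simp_all add: ip_x2_pderiv_diag_sum ladder_r_def b_0 algebra_simps)
    next
      case 4
      then have n: "n = Suc m" by simp
      show ?thesis
        unfolding * unfolding n by (simp add: ip_X_P_P ip_P_P ip_x2_pderiv_pred h_Suc algebra_simps)
    next
      case 5
      then obtain k where n: "n = Suc (m + 1 + k)" by (auto simp: le_iff_add)
      then show ?thesis
        unfolding * unfolding n by (simp add: ip_X_P_P ip_P_P ip_x2_pderiv_below h_Suc)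
    qed
  qed
  then have "x2_pderiv (P n) - ?R = 0" by (rule eq_0_if_orthogonal)
  then show ?thesis by simp
qed

lemma lowering_poly:
  "x\<^sup>2 * poly (pderiv (P n)) x = b n * (x + (a n - 2 * n - 1 - \<alpha>)) * poly (P (n - 1)) x
     + (n * x - ladder_r n) * poly (P n) x"
  using arg_cong[OF lowering[of n], of "\<lambda>p. poly p x"]
  by (simp add: x2_pderiv_def algebra_simps power2_eq_square)

lemma ladder_r_add_Suc: "ladder_r (Suc n) + ladder_r n = t - a n * (a n - 2 * n - 1 - \<alpha>)"
  using sum_a[of n] by (simp add: ladder_r_def algebra_simps power2_eq_square)

text \<open>The recurrence eliminates \<open>P (n - 1)\<close> from the lowering relation, and
  \<open>ladder_r_add_Suc\<close> trades \<open>ladder_r n\<close> for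
  \<open>ladder_r (Suc n)\<close>.\<close>

lemma raising:
  "x\<^sup>2 * poly (pderiv (P n)) x = (x\<^sup>2 - (n + 1 + \<alpha>) * x - t + ladder_r (Suc n)) * poly (P n) x
     - (x + (a n - 2 * n - 1 - \<alpha>)) * poly (P (Suc n)) x"
proof -
  have rec: "b n * poly (P (n - 1)) x = x * poly (P n) x - poly (P (Suc n)) x - a n * poly (P n) x"
    using arg_cong[OF recurrence[of n], of "\<lambda>p. poly p x"] by simp
  have "x\<^sup>2 * poly (pderiv (P n)) x =
    (x + (a n - 2 * n - 1 - \<alpha>)) * (b n * poly (P (n - 1)) x) + (n * x - ladder_r n) * poly (P n) x"
    using lowering_poly[of x n] by (simp add: algebra_simps)
  moreover have "ladder_r n = t - a n * (a n - 2 * n - 1 - \<alpha>) - ladder_r (Suc n)"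
    using ladder_r_add_Suc[of n] by simp
  ultimately show ?thesis
    unfolding rec by (simp add: algebra_simps power2_eq_square)
qed

text \<open>The argument is (x P_n^2 w)' / w without its non-polynomial part (t / x) P_n^2. The
  value serves to determine the sign of \<open>a n - 2 * n - 1 - \<alpha>\<close>.\<close>

lemma L_Euler_P_P:
  "L (pCons 0 (pderiv (P n * P n)) + smult (1 + \<alpha>) (P n * P n) - pCons 0 (P n * P n))
    = (2 * n + 1 + \<alpha> - a n) * h n"
proof -
  have "degree (pCons 0 (pderiv (P n))) \<le> n"
    by (cases n) (simp_all add: degree_P degree_pderiv P_0)
  moreover have "coeff (pCons 0 (pderiv (P n))) n = n"
    using lead_P[of n] by (cases n) (simp_all add: degree_P coeff_pderiv)
  ultimately have "ip (pCons 0 (pderiv (P n))) (P n) = n * h n"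
    by (simp add: ip_P_right)
  then have "L (pCons 0 (P n * pderiv (P n))) = n * h n"
    by (simp add: ip_def mult.commute)
  moreover have "L (pCons 0 (P n * P n)) = a n * h n"
    using ip_X_P_P[of n n] by (simp add: ip_def)
  moreover have "pCons 0 (pderiv (P n * P n)) = smult 2 (pCons 0 (P n * pderiv (P n)))"
    by (simp add: pderiv_mult mult.commute poly_eq_poly_eq_iff[symmetric] fun_eq_iff)
  ultimately show ?thesis
    by (simp add: L_add L_diff L_smult orth algebra_simps del: smult_pCons mult_pCons_left)
qed

end

section \<open>Integrability, boundary values and integration by parts for the weight\<close>

lemma set_integrable_powr_exp:
  fixes c :: real
  assumes "c > -1"
  shows "set_integrable lborel {0<..} (\<lambda>x. x powr c * exp (- x))"
proof -
  have "(\<lambda>x. x powr c / exp x) integrable_on {0..}"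
    using Gamma_integral_real[of "c + 1"] assms by (auto simp: integrable_on_def)
  then have "(\<lambda>x. x powr c / exp x) absolutely_integrable_on {0..}"
    by (rule nonnegative_absolutely_integrable_1) simp
  then have "(\<lambda>x. x powr c / exp x) absolutely_integrable_on {0<..}"
    by (rule set_integrable_subset) auto
  \<comment> \<open>Absolute integrability refers to the completed measure; Borel measurability of
    the integrand brings it back to \<open>lborel\<close>.\<close>
  then have "set_integrable lborel {0<..} (\<lambda>x. x powr c / exp x)"
    unfolding set_integrable_def by (subst (asm) integrable_completion) auto
  then show ?thesis
    by (simp add: exp_minus divide_inverse)
qed

text \<open>The bounded factor \<open>g\<close> covers both exp(-t/x) and (t/x) exp(-t/x).\<close>

lemma set_integrable_poly_powr_exp:
  fixes \<alpha> :: real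
  assumes "\<alpha> > -1" and [measurable]: "g \<in> borel_measurable borel"
    and g: "\<And>x. x > 0 \<Longrightarrow> \<bar>g x\<bar> \<le> 1"
  shows "set_integrable lborel {0<..} (\<lambda>x. poly q x * (x powr \<alpha> * exp (- x) * g x))"
proof -
  have mono: "set_integrable lborel {0<..} (\<lambda>x. x ^ k * (x powr \<alpha> * exp (- x) * g x))" for k
  proof (rule set_integrable_bound)
    show "set_integrable lborel {0<..} (\<lambda>x. x powr (\<alpha> + k) * exp (- x))"
      using assms(1) by (intro set_integrable_powr_exp) simp
    show "set_borel_measurable lborel {0<..} (\<lambda>x. x ^ k * (x powr \<alpha> * exp (- x) * g x))"
      unfolding set_borel_measurable_def by measurable
    have "\<bar>x ^ k * (x powr \<alpha> * exp (- x) * g x)\<bar> \<le> x powr (\<alpha> + k) * exp (- x)" if "x > 0" for x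
    proof -
      have "\<bar>x ^ k * (x powr \<alpha> * exp (- x) * g x)\<bar> = x powr (\<alpha> + k) * exp (- x) * \<bar>g x\<bar>"
        using that by (simp add: abs_mult powr_add powr_realpow)
      also have "\<dots> \<le> x powr (\<alpha> + k) * exp (- x)"
        using g[OF that] by (intro mult_right_le_one_le) auto
      finally show ?thesis .
    qed
    then show "AE x in lborel. x \<in> {0<..} \<longrightarrow> norm (x ^ k * (x powr \<alpha> * exp (- x) * g x))
        \<le> norm (x powr (\<alpha> + k) * exp (- x))"
      by auto
  qed
  have "set_integrable lborel {0<..}
    (\<lambda>x. \<Sum>k\<le>degree q. coeff q k * (x ^ k * (x powr \<alpha> * exp (- x) * g x)))"
    using mono by (simp add: set_integrable_def sum_distrib_left integrable_sum mult.left_commute)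
  then show ?thesis
    by (simp add: poly_altdef sum_distrib_right mult.assoc)
qed

context
  fixes \<alpha> t :: real
  assumes \<alpha>: "\<alpha> > -1" and t: "t \<ge> 0"
begin

lemma laguerre_weight_eq: "laguerre_weight t \<alpha> x = x powr \<alpha> * exp (- x) * exp (- t / x)"
  by (simp add: laguerre_weight_def exp_diff exp_minus field_simps)

lemma set_integrable_weight:
  "set_integrable lborel {0<..} (\<lambda>x. poly q x * laguerre_weight t \<alpha> x)"
  unfolding laguerre_weight_eq using \<alpha> t
  by (intro set_integrable_poly_powr_exp) auto

text \<open>The factor t/x must be absorbed by exp(-t/x), using u <= exp u, since x powr (\<alpha> -
  1) need not be integrable near 0.\<close>

lemma set_integrable_weight_inverse:
  "set_integrable lborel {0<..} (\<lambda>x. t / x * poly q x * laguerre_weight t \<alpha> x)"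
proof -
  have "\<bar>t / x * exp (- t / x)\<bar> \<le> 1" if "x > 0" for x
  proof -
    have "t / x \<le> exp (t / x)"
      using exp_ge_add_one_self[of "t / x"] by linarith
    then show ?thesis
      using that t by (simp add: exp_minus field_simps)
  qed
  then have "set_integrable lborel {0<..}
      (\<lambda>x. poly q x * (x powr \<alpha> * exp (- x) * (t / x * exp (- t / x))))"
    using \<alpha> by (intro set_integrable_poly_powr_exp) auto
  then show ?thesis
    unfolding laguerre_weight_eq by (simp add: mult_ac)
qed

text \<open>The extra factor x gives the positive exponent \<alpha> + 1, and the exponential is at
  most 1.\<close>

lemma boundary_at_0: "((\<lambda>x. poly q x * (x * laguerre_weight t \<alpha> x)) \<longlongrightarrow> 0) (at_right 0)"
proof -
  have "((\<lambda>x. x powr (\<alpha> + 1)) \<longlongrightarrow> 0 powr (\<alpha> + 1)) (at_right 0)"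
    using \<alpha> by (intro tendsto_powr' tendsto_ident_at tendsto_const)
      (auto simp: eventually_at_filter)
  moreover have "((\<lambda>x. \<bar>poly q x\<bar>) \<longlongrightarrow> \<bar>poly q 0\<bar>) (at_right 0)"
    by (intro tendsto_intros)
  ultimately have "((\<lambda>x. \<bar>poly q x\<bar> * x powr (\<alpha> + 1)) \<longlongrightarrow> \<bar>poly q 0\<bar> * 0 powr (\<alpha> + 1)) (at_right 0)"
    by (intro tendsto_mult)
  then have *: "((\<lambda>x. \<bar>poly q x\<bar> * x powr (\<alpha> + 1)) \<longlongrightarrow> 0) (at_right 0)"
    by simp
  show ?thesis
  proof (rule tendsto_0_le[OF *, of _ 1])
    have "\<bar>poly q x * (x * laguerre_weight t \<alpha> x)\<bar> \<le> \<bar>poly q x\<bar> * x powr (\<alpha> + 1)"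
      if "x > 0" for x
    proof -
      have "0 \<le> t / x" using that t by simp
      then have "exp (- x - t / x) \<le> 1" using that by simp
      then have "x powr (\<alpha> + 1) * exp (- x - t / x) \<le> x powr (\<alpha> + 1)"
        by (intro mult_left_le) auto
      then have "\<bar>poly q x\<bar> * (x powr (\<alpha> + 1) * exp (- x - t / x)) \<le> \<bar>poly q x\<bar> * x powr (\<alpha> + 1)"
        by (intro mult_left_mono) auto
      then show ?thesis
        using that by (simp add: abs_mult laguerre_weight_def powr_add mult_ac)
    qed
    then show "\<forall>\<^sub>F x in at_right 0. norm (poly q x * (x * laguerre_weight t \<alpha> x))
        \<le> norm (\<bar>poly q x\<bar> * x powr (\<alpha> + 1)) * 1"
      by (auto simp: eventually_at_filter)
  qed
qed

lemma boundary_at_top: "((\<lambda>x. poly q x * (x * laguerre_weight t \<alpha> x)) \<longlongrightarrow> 0) at_top"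
proof -
  have mono: "((\<lambda>x. x ^ k * (x * laguerre_weight t \<alpha> x)) \<longlongrightarrow> 0) at_top" for k
  proof -
    have *: "((\<lambda>x. x powr (real k + \<alpha> + 1) * exp (- x)) \<longlongrightarrow> 0) at_top"
      by real_asymp
    show ?thesis
    proof (rule tendsto_0_le[OF *, of _ 1])
      have "\<bar>x ^ k * (x * laguerre_weight t \<alpha> x)\<bar> \<le> x powr (real k + \<alpha> + 1) * exp (- x)"
        if "x > 0" for x
      proof -
        have "x ^ k * (x * laguerre_weight t \<alpha> x) = x powr (real k + \<alpha> + 1) * exp (- x) * exp (- t / x)"
          using that by (simp add: laguerre_weight_eq powr_add powr_realpow)
        moreover have "exp (- t / x) \<le> 1" using that t by simp
        ultimately show ?thesis
          by (simp add: abs_mult mult_left_le)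
      qed
      then show "\<forall>\<^sub>F x in at_top. norm (x ^ k * (x * laguerre_weight t \<alpha> x))
          \<le> norm (x powr (real k + \<alpha> + 1) * exp (- x)) * 1"
        by (intro eventually_mono[OF eventually_gt_at_top[of 0]]) auto
    qed
  qed
  have "((\<lambda>x. \<Sum>k\<le>degree q. coeff q k * (x ^ k * (x * laguerre_weight t \<alpha> x)))
      \<longlongrightarrow> (\<Sum>k\<le>degree q. coeff q k * 0)) at_top"
    by (intro tendsto_sum tendsto_mult tendsto_const mono)
  then show ?thesis
    by (simp add: poly_altdef sum_distrib_right mult.assoc)
qed

lemma weight_deriv:
  assumes "x > 0"
  shows "((\<lambda>x. poly q x * (x * laguerre_weight t \<alpha> x)) has_real_derivative
     poly (pCons 0 (pderiv q) + smult (1 + \<alpha>) q - pCons 0 q) x * laguerre_weight t \<alpha> x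
       + t / x * poly q x * laguerre_weight t \<alpha> x) (at x)"
  unfolding laguerre_weight_def using assms
  by (auto intro!: derivative_eq_intros simp: powr_diff field_simps power2_eq_square)

text \<open>The fundamental theorem of calculus with zero boundary values. It is used for q = x p,
  where the pole cancels, and for q = P_k^2, where the right-hand side has a sign.\<close>

lemma integral_weight_deriv:
  "(LBINT x:{0<..}. poly (pCons 0 (pderiv q) + smult (1 + \<alpha>) q - pCons 0 q) x * laguerre_weight t \<alpha> x)
    = - (LBINT x:{0<..}. t / x * poly q x * laguerre_weight t \<alpha> x)"
proof -
  define f where "f x = poly (pCons 0 (pderiv q) + smult (1 + \<alpha>) q - pCons 0 q) x * laguerre_weight t \<alpha> x
       + t / x * poly q x * laguerre_weight t \<alpha> x" for x
  have "(LBINT x=ereal 0..\<infinity>. f x) = 0 - 0"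
  proof (rule interval_integral_FTC_integrable)
    show "((\<lambda>x. poly q x * (x * laguerre_weight t \<alpha> x)) has_vector_derivative f x) (at x)"
      if "ereal 0 < ereal x" "ereal x < \<infinity>" for x
      using weight_deriv[of x q] that
      unfolding f_def has_real_derivative_iff_has_vector_derivative[symmetric] by simp
    show "isCont f x" if "ereal 0 < ereal x" "ereal x < \<infinity>" for x
      using that unfolding f_def laguerre_weight_def by (auto intro!: continuous_intros)
    show "set_integrable lborel (einterval (ereal 0) \<infinity>) f"
      unfolding f_def einterval_eq_Ici
      by (intro set_integral_add(1) set_integrable_weight set_integrable_weight_inverse)
    show "(((\<lambda>x. poly q x * (x * laguerre_weight t \<alpha> x)) \<circ> real_of_ereal) \<longlongrightarrow> 0) (at_right (ereal 0))"
      unfolding ereal_tendsto_simps by (rule boundary_at_0)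
    show "(((\<lambda>x. poly q x * (x * laguerre_weight t \<alpha> x)) \<circ> real_of_ereal) \<longlongrightarrow> 0) (at_left \<infinity>)"
      unfolding ereal_tendsto_simps by (rule boundary_at_top)
  qed simp
  then have "(LBINT x:{0<..}. f x) = 0"
    by (simp only: interval_integral_to_infinity_eq diff_self)
  then show ?thesis
    unfolding f_def
    by (subst (asm) set_integral_add(2)[OF set_integrable_weight set_integrable_weight_inverse]) simp
qed

end

section \<open>From the ladder relations to the differential equation\<close>

text \<open>Differentiate the lowering relation, insert the raising relation for g', and replace
  \<beta> A g by f' + B f. The first relation is differentiated, so it is assumed on the whole
  half-line; the second is needed only at x.\<close>

lemma ladder_ode:
  fixes f g A B :: "real \<Rightarrow> real"
  assumes "x > 0" and Ax: "A x \<noteq> 0"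
    and f: "\<And>y. y > 0 \<Longrightarrow> (f has_real_derivative \<beta> * A y * g y - B y * f y) (at y)"
    and g: "(g has_real_derivative (B x + v) * g x - C * f x) (at x)"
    and A: "A field_differentiable at x" and B: "B field_differentiable at x"
  shows "deriv (deriv f) x - (v + deriv A x / A x) * deriv f x
     + (deriv B x - (B x)\<^sup>2 - v * B x + \<beta> * A x * C - deriv A x * B x / A x) * f x = 0"
proof -
  have df: "deriv f y = \<beta> * A y * g y - B y * f y" if "y > 0" for y
    using f[OF that] by (rule DERIV_imp_deriv)
  have dA: "(A has_real_derivative deriv A x) (at x)" and dB: "(B has_real_derivative deriv B x) (at x)"
    using A B by (simp_all add: DERIV_deriv_iff_field_differentiable)
  have "((\<lambda>y. \<beta> * A y * g y - B y * f y) has_real_derivative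
     \<beta> * (deriv A x * g x + A x * ((B x + v) * g x - C * f x))
     - (deriv B x * f x + B x * (\<beta> * A x * g x - B x * f x))) (at x)"
    by (rule DERIV_cong[OF DERIV_diff[OF DERIV_mult[OF DERIV_cmult[OF dA] g]
        DERIV_mult[OF dB f[OF \<open>x > 0\<close>]]]]) (simp add: algebra_simps)
  then have "deriv (\<lambda>y. \<beta> * A y * g y - B y * f y) x
    = \<beta> * (deriv A x * g x + A x * ((B x + v) * g x - C * f x))
     - (deriv B x * f x + B x * (\<beta> * A x * g x - B x * f x))"
    by (rule DERIV_imp_deriv)
  moreover have "\<forall>\<^sub>F y in nhds x. deriv f y = \<beta> * A y * g y - B y * f y"
    using eventually_nhds_in_open[of "{0<..}" x] \<open>x > 0\<close> by (auto elim!: eventually_mono simp: df)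
  then have "deriv (deriv f) x = deriv (\<lambda>y. \<beta> * A y * g y - B y * f y) x"
    by (rule deriv_cong_ev) simp
  \<comment> \<open>Naming the quotient leaves a polynomial identity without division.\<close>
  moreover define q where "q = deriv A x / A x"
  then have "deriv A x = q * A x" "deriv A x * B x / A x = q * B x"
    using Ax by simp_all
  ultimately show ?thesis
    unfolding df[OF \<open>x > 0\<close>] by (simp add: Ax algebra_simps power2_eq_square)
qed

theorem theorem2p3:
  fixes \<alpha> t x :: real and n :: nat
    and P :: "nat \<Rightarrow> real poly" and a b :: "nat \<Rightarrow> real"
  assumes "\<alpha> > -1" and "t \<ge> 0" and "n \<ge> 1"
    and "monic_orthogonal_polys (laguerre_weight t \<alpha>) P"
    and "recurrence_coeffs P a b"
    and "x > 0"
  defines "A \<equiv> ladder_A \<alpha> a" and "B \<equiv> ladder_B t \<alpha> a b n" and "v' \<equiv> v_deriv t \<alpha>"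
  shows "deriv (deriv (poly (P n))) x
         - (v' x + deriv (A n) x / A n x) * deriv (poly (P n)) x
         + (deriv B x - (B x)\<^sup>2 - v' x * B x + b n * A n x * A (n - 1) x
            - deriv (A n) x * B x / A n x) * poly (P n) x = 0"
proof -
  define w where "w = laguerre_weight t \<alpha>"
  define L where "L p = (LBINT x:{0<..}. poly p x * w x)" for p
  \<comment> \<open>The locale demands value 0 at index 0, where \<open>b\<close> is unconstrained;
    \<open>b'\<close> agrees with \<open>b\<close> at n since n >= 1.\<close>
  define b' where "b' = b(0 := 0)"
  obtain h where h: "\<And>j. h j > 0"
    "\<And>j k. (LBINT x:{0<..}. poly (P j) x * poly (P k) x * w x) = (if j = k then h j else 0)"
    using assms(4) unfolding monic_orthogonal_polys_def w_def by blast
  note int = set_integrable_weight[OF assms(1,2), folded w_def]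
  note euler = integral_weight_deriv[OF assms(1,2), folded w_def]
  have L_add: "L (p + q) = L p + L q" for p q
    unfolding L_def using set_integral_add(2)[OF int int, of p q] by (simp add: distrib_right)
  have L_smult: "L (smult c p) = c * L p" for c p
    unfolding L_def by (simp add: mult.assoc)
  interpret laguerre_sequence L P h a b' \<alpha> t
  proof
    show "degree (P n) = n" "lead_coeff (P n) = 1" for n
      using assms(4) unfolding monic_orthogonal_polys_def by blast+
    show "L (P j * P k) = (if j = k then h j else 0)" for j k
      unfolding L_def by (simp add: h(2))
    show "pCons 0 (P n) = P (Suc n) + smult (a n) (P n) + smult (b' n) (P (n - 1))" for n
      using assms(5) unfolding recurrence_coeffs_def b'_def by (cases n) auto
    show "L (x2_pderiv p) + (2 + \<alpha>) * L (pCons 0 p) + t * L p - L (pCons 0 (pCons 0 p)) = 0" for p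
    proof -
      let ?q = "pCons 0 p"
      have "(LBINT x:{0<..}. t / x * poly ?q x * w x) = (LBINT x:{0<..}. t * (poly p x * w x))"
        by (intro set_lebesgue_integral_cong) auto
      then have "L (pCons 0 (pderiv ?q) + smult (1 + \<alpha>) ?q - pCons 0 ?q) = - t * L p"
        unfolding L_def euler by simp
      moreover have "pCons 0 (pderiv ?q) + smult (1 + \<alpha>) ?q - pCons 0 ?q
          = x2_pderiv p + smult (2 + \<alpha>) ?q + smult (- 1) (pCons 0 ?q)"
        by (simp add: x2_pderiv_def pderiv_pCons poly_eq_poly_eq_iff[symmetric] fun_eq_iff algebra_simps)
      ultimately have "L (x2_pderiv p + smult (2 + \<alpha>) ?q + smult (- 1) (pCons 0 ?q)) = - t * L p"
        by (simp only:)
      then show ?thesis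
        by (simp only: L_add L_smult)
    qed
  qed (simp_all add: L_add L_smult h(1) b'_def)

  \<comment> \<open>By \<open>euler\<close> with q = P_k^2, minus this quantity times
    \<open>h k\<close> equals minus a nonnegative integral.\<close>
  have c_nonneg: "a k - 2 * k - 1 - \<alpha> \<ge> 0" for k
  proof -
    have "(LBINT x:{0<..}. t / x * poly (P k * P k) x * w x) \<ge> 0"
      unfolding set_lebesgue_integral_def using assms(2)
      by (intro Bochner_Integration.integral_nonneg)
        (auto simp: indicator_def w_def laguerre_weight_def)
    then have "L (pCons 0 (pderiv (P k * P k)) + smult (1 + \<alpha>) (P k * P k) - pCons 0 (P k * P k)) \<le> 0"
      unfolding L_def euler by simp
    then show ?thesis
      using h(1)[of k] unfolding L_Euler_P_P by (simp add: mult_le_0_iff)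
  qed

  obtain m where n: "n = Suc m"
    using assms(3) by (cases n) auto
  have b: "b' n = b n" by (simp add: b'_def n)
  have B: "B y = - n / y + ladder_r n / y\<^sup>2" for y
  proof -
    \<comment> \<open>Here n >= 1 matters: it makes the denominator of \<open>B\<close> positive for
      every \<alpha> > -1.\<close>
    have "2 * n + \<alpha> > 0" using assms(1,3) by simp
    moreover have "n * t - b n * (a n + a (n - 1) - 4 * n - 2 * \<alpha>) = (2 * n + \<alpha>) * ladder_r n"
      using ladder_r_eq[of n] by (simp add: b)
    ultimately show ?thesis
      unfolding B_def ladder_B_def by simp
  qed
  have A: "A k y = (y + (a k - 2 * k - 1 - \<alpha>)) / y\<^sup>2" if "y > 0" for k y
    using that unfolding A_def ladder_A_def by (simp add: field_simps power2_eq_square)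
  have f: "(poly (P n) has_real_derivative b n * A n y * poly (P m) y - B y * poly (P n) y) (at y)"
    if "y > 0" for y
  proof -
    have "poly (pderiv (P n)) y = y\<^sup>2 * poly (pderiv (P n)) y / y\<^sup>2"
      using that by simp
    also have "\<dots> = b n * A n y * poly (P m) y - B y * poly (P n) y"
      unfolding lowering_poly A[OF that] B b
      using that by (simp add: n field_simps power2_eq_square)
    finally show ?thesis
      by (metis poly_DERIV)
  qed
  have g: "(poly (P m) has_real_derivative
      (B x + v' x) * poly (P m) x - A (n - 1) x * poly (P n) x) (at x)"
  proof -
    have "poly (pderiv (P m)) x = x\<^sup>2 * poly (pderiv (P m)) x / x\<^sup>2"
      using assms(6) by simp
    also have "\<dots> = (B x + v' x) * poly (P m) x - A (n - 1) x * poly (P n) x"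
      \<comment> \<open>Raising is applied at m = n - 1, so its \<open>ladder_r (Suc m)\<close> is
        the coefficient in \<open>B\<close>.\<close>
      unfolding raising A[OF assms(6)] B v'_def v_deriv_def
      using assms(6) by (simp add: n field_simps power2_eq_square)
    finally show ?thesis
      by (metis poly_DERIV)
  qed
  show ?thesis
  proof (rule ladder_ode[OF assms(6) _ f g])
    show "A n x \<noteq> 0"
      using c_nonneg[of n] assms(6) by (simp add: A[OF assms(6)])
    show "A n field_differentiable at x" "B field_differentiable at x"
      using assms(1,3,6) unfolding A_def B_def ladder_A_def[abs_def] ladder_B_def[abs_def]
      by (auto intro!: derivative_intros)
  qed
qed

end
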